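(* Let $L$ be a semiprime Lie ideal in a $C^*$-algebra $A$, and let $I_0$ and $I_{\mathrm{min}}$ denote the two-sided ideals in $A$ generated by $[L,L]$ and $[A,L]$, respectively. Then \[ I_0 \subseteq I_{\mathrm{min}}\subseteq \sqrt{I_{\mathrm{min}}} = \sqrt{I_0} \quad\text{and}\quad L = T(\sqrt{I_{\mathrm{min}}}). \]
   Context: A $C^*$-algebra $A$ need not be unital. For $a,b\in A$ put $[a,b]:=ab-ba$; for subsets $E,F\subseteq A$, $[E,F]$ denotes the linear span of $\{[a,b]:a\in E,b\in F\}$. A two-sided ideal in $A$ is a linear subspace $I\subseteq A$ (not necessarily closed) with $ax,xa\in I$ for all $a\in A$, $x\in I$; the two-sided ideal generated by a subset is the smallest such ideal containing it (no closure is taken). A two-sided ideal $I$ is prime if $I\neq A$ and, for all two-sided ideals $I_1,I_2$, $I_1I_2\subseteq I$ implies $I_1\subseteq I$ or $I_2\subseteq I$. For a two-sided ideal $I$ in $A$, $\sqrt{I}$ denotes its semiprime closure, that is, the intersection of all prime ideals of $A$ containing $I$ (equal to $A$ if there are none). A Lie ideal in $A$ is a linear subspace $L\subseteq A$ (not necessarily closed) with $[A,L]\subseteq L$. A Lie ideal $L$ is semiprime if for every Lie ideal $K\subseteq A$ with $[K,K]\subseteq L$ one has $K\subseteq L$. For a linear subspace $L\subseteq A$, the full normalizer subspace is $T(L):=\{a\in A:[A,a]\subseteq L\}$. *)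

theory Defs
  imports Complex_Main
begin

text \<open>
  A complex algebra structure on top of the library's real Banach algebras. Since
  \<open>real_normed_algebra\<close> has no unit element, the algebras may be non-unital, and the
  zero algebra is allowed.
\<close>

class complex_vector = real_vector +
  fixes scaleC :: "complex \<Rightarrow> 'a \<Rightarrow> 'a"  (infixr \<open>*\<^sub>C\<close> 75)
  assumes scaleC_add_right: "a *\<^sub>C (x + y) = a *\<^sub>C x + a *\<^sub>C y"
    and scaleC_add_left: "(a + b) *\<^sub>C x = a *\<^sub>C x + b *\<^sub>C x"
    and scaleC_scaleC: "a *\<^sub>C (b *\<^sub>C x) = (a * b) *\<^sub>C x"
    and scaleC_one: "1 *\<^sub>C x = x"
    and scaleC_of_real: "complex_of_real r *\<^sub>C x = r *\<^sub>R x"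

class cstar_algebra = complex_vector + real_normed_algebra + banach +
  fixes star :: "'a \<Rightarrow> 'a"
  assumes norm_scaleC: "norm (a *\<^sub>C x) = cmod a * norm x"
    and mult_scaleC_left: "(a *\<^sub>C x) * y = a *\<^sub>C (x * y)"
    and mult_scaleC_right: "x * (a *\<^sub>C y) = a *\<^sub>C (x * y)"
    and star_star: "star (star x) = x"
    and star_add: "star (x + y) = star x + star y"
    and star_scaleC: "star (a *\<^sub>C x) = cnj a *\<^sub>C star x"
    and star_mult: "star (x * y) = star y * star x"
    and cstar_identity: "norm (star x * x) = (norm x)\<^sup>2"

global_interpretation complex_vector: vector_space "scaleC :: complex \<Rightarrow> 'a \<Rightarrow> 'a::complex_vector"
  defines csubspace_raw_def: csubspace = complex_vector.subspace
    and cspan_raw_def: cspan = complex_vector.span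
  by unfold_locales (simp_all add: scaleC_add_right scaleC_add_left scaleC_scaleC scaleC_one)

instantiation complex :: cstar_algebra
begin

definition scaleC_complex :: "complex \<Rightarrow> complex \<Rightarrow> complex" where
  "scaleC_complex = (*)"

definition star_complex :: "complex \<Rightarrow> complex" where
  "star_complex = cnj"

instance
  by standard
    (simp_all add: scaleC_complex_def star_complex_def algebra_simps norm_mult
      scaleR_conv_of_real power2_eq_square)

end

definition commutator :: "'a::cstar_algebra \<Rightarrow> 'a \<Rightarrow> 'a" where
  "commutator a b = a * b - b * a"

definition commutator_span :: "'a::cstar_algebra set \<Rightarrow> 'a set \<Rightarrow> 'a set" where
  "commutator_span E F = cspan {commutator a b | a b. a \<in> E \<and> b \<in> F}"

definition two_sided_ideal :: "'a::cstar_algebra set \<Rightarrow> bool" where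
  "two_sided_ideal I \<longleftrightarrow> csubspace I \<and> (\<forall>a. \<forall>x\<in>I. a * x \<in> I \<and> x * a \<in> I)"

definition ideal_generated :: "'a::cstar_algebra set \<Rightarrow> 'a set" where
  "ideal_generated S = two_sided_ideal hull S"

definition ideal_product :: "'a::cstar_algebra set \<Rightarrow> 'a set \<Rightarrow> 'a set" where
  "ideal_product I J = cspan {x * y | x y. x \<in> I \<and> y \<in> J}"

definition prime_ideal :: "'a::cstar_algebra set \<Rightarrow> bool" where
  "prime_ideal P \<longleftrightarrow> two_sided_ideal P \<and> P \<noteq> UNIV \<and>
     (\<forall>I J. two_sided_ideal I \<longrightarrow> two_sided_ideal J \<longrightarrow> ideal_product I J \<subseteq> P \<longrightarrow> I \<subseteq> P \<or> J \<subseteq> P)"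

text \<open>If no prime ideal contains \<open>I\<close>, the intersection below is the whole algebra.\<close>

definition semiprime_closure :: "'a::cstar_algebra set \<Rightarrow> 'a set" where
  "semiprime_closure I = \<Inter>{P. prime_ideal P \<and> I \<subseteq> P}"

definition lie_ideal :: "'a::cstar_algebra set \<Rightarrow> bool" where
  "lie_ideal L \<longleftrightarrow> csubspace L \<and> commutator_span UNIV L \<subseteq> L"

definition semiprime_lie_ideal :: "'a::cstar_algebra set \<Rightarrow> bool" where
  "semiprime_lie_ideal L \<longleftrightarrow> lie_ideal L \<and>
     (\<forall>K. lie_ideal K \<longrightarrow> commutator_span K K \<subseteq> L \<longrightarrow> K \<subseteq> L)"

definition full_normalizer :: "'a::cstar_algebra set \<Rightarrow> 'a set" where
  "full_normalizer L = {a. commutator_span UNIV {a} \<subseteq> L}"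

end

theory Submission
  imports Defs
begin

text \<open>
  The argument is purely algebraic. Semiprimeness of \<open>L\<close> gives two absorption properties. First,
  the full normalizer \<open>T(L)\<close> is a Lie ideal whose commutators lie in \<open>L\<close>, so \<open>T(L) = L\<close>; since
  full normalizers are closed under multiplication, \<open>L\<close> is a subalgebra, and an old observation
  of Herstein then puts the whole ideal \<open>I\<^sub>0\<close> generated by \<open>[L,L]\<close> inside \<open>L\<close>
  (\<open>ideal_generated_commutators_subset\<close>). Second, if \<open>J J\<close> is contained in an ideal inside \<open>L\<close>,
  then \<open>[J,J] \<subseteq> L\<close> and hence \<open>J \<subseteq> L\<close>; so the largest ideal inside \<open>L\<close> is a semiprime ideal
  (\<open>semiprime_largest_ideal_within\<close>).

  A semiprime ideal is an intersection of prime ideals (\<open>semiprime_closure_subset_semiprime\<close>), so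
  \<open>\<surd>I\<^sub>0\<close> still lies inside \<open>L\<close>. Conversely, modulo a prime ideal containing \<open>I\<^sub>0\<close> the Lie ideal \<open>L\<close>
  becomes commutative, and Herstein's theorem says that a commutative Lie ideal of a semiprime
  algebra is central (\<open>commutator_in_semiprime\<close>). Hence every such prime contains \<open>[A,L]\<close>,
  which gives \<open>\<surd>I\<^sub>m\<^sub>i\<^sub>n = \<surd>I\<^sub>0\<close>. Finally \<open>[A,L] \<subseteq> \<surd>I\<^sub>m\<^sub>i\<^sub>n \<subseteq> L\<close> yields
  \<open>L \<subseteq> T(\<surd>I\<^sub>m\<^sub>i\<^sub>n) \<subseteq> T(L) = L\<close>.
\<close>

section \<open>Two-sided ideals\<close>

lemmas csubspace_zero = complex_vector.subspace_0
lemmas csubspace_add = complex_vector.subspace_add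
lemmas csubspace_diff = complex_vector.subspace_diff
lemmas csubspace_scale = complex_vector.subspace_scale

lemma csubspaceI:
  assumes "0 \<in> S" "\<And>x y. x \<in> S \<Longrightarrow> y \<in> S \<Longrightarrow> x + y \<in> S" "\<And>c x. x \<in> S \<Longrightarrow> c *\<^sub>C x \<in> S"
  shows "csubspace S"
  using assms by (simp add: complex_vector.subspace_def)

lemma scaleC_zero_right [simp]: "c *\<^sub>C (0::'a::complex_vector) = 0"
  by (rule complex_vector.scale_zero_right)

lemma csubspace_double:
  assumes "csubspace S" "x + x \<in> S"
  shows "x \<in> S"
proof -
  have "(1/2) *\<^sub>C (x + x) = ((1/2) + (1/2)) *\<^sub>C x"
    by (simp only: scaleC_add_right scaleC_add_left)
  then have "(1/2) *\<^sub>C (x + x) = x"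
    by (simp add: scaleC_one)
  then show ?thesis
    using csubspace_scale[OF assms, of "1/2"] by simp
qed

lemma two_sided_idealD:
  assumes "two_sided_ideal I"
  shows two_sided_ideal_csubspace: "csubspace I"
    and two_sided_ideal_mult_left: "\<And>a x. x \<in> I \<Longrightarrow> a * x \<in> I"
    and two_sided_ideal_mult_right: "\<And>a x. x \<in> I \<Longrightarrow> x * a \<in> I"
  using assms by (auto simp: two_sided_ideal_def)

lemma two_sided_idealI:
  assumes "csubspace I" "\<And>a x. x \<in> I \<Longrightarrow> a * x \<in> I" "\<And>a x. x \<in> I \<Longrightarrow> x * a \<in> I"
  shows "two_sided_ideal I"
  using assms by (auto simp: two_sided_ideal_def)

lemma two_sided_ideal_Inter:
  assumes "\<And>I. I \<in> \<I> \<Longrightarrow> two_sided_ideal I"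
  shows "two_sided_ideal (\<Inter>\<I>)"
  by (rule two_sided_idealI)
    (use assms in \<open>auto intro!: complex_vector.subspace_Inter dest: two_sided_idealD\<close>)

lemma two_sided_ideal_generated: "two_sided_ideal (ideal_generated S)"
  unfolding ideal_generated_def by (rule hull_in) (simp add: two_sided_ideal_Inter)

lemma ideal_generated_superset: "S \<subseteq> ideal_generated S"
  unfolding ideal_generated_def by (rule hull_subset)

lemma ideal_generated_minimal:
  "S \<subseteq> I \<Longrightarrow> two_sided_ideal I \<Longrightarrow> ideal_generated S \<subseteq> I"
  unfolding ideal_generated_def by (rule hull_minimal)

lemma two_sided_ideal_sum:
  assumes I: "two_sided_ideal I" and J: "two_sided_ideal J"
  shows "two_sided_ideal {x + y | x y. x \<in> I \<and> y \<in> J}"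
proof (rule two_sided_idealI)
  show "csubspace {x + y | x y. x \<in> I \<and> y \<in> J}"
    by (rule complex_vector.subspace_sums)
      (use I J in \<open>simp_all add: two_sided_ideal_csubspace\<close>)
qed (use I J in \<open>auto simp: distrib_left distrib_right; blast dest: two_sided_idealD\<close>)+

lemma two_sided_ideal_Union_chain:
  assumes ideals: "\<And>I. I \<in> \<C> \<Longrightarrow> two_sided_ideal I"
    and chain: "subset.chain \<A> \<C>" and ne: "\<C> \<noteq> {}"
  shows "two_sided_ideal (\<Union>\<C>)"
proof (rule two_sided_idealI)
  show "csubspace (\<Union>\<C>)"
  proof (rule csubspaceI)
    show "0 \<in> \<Union>\<C>"
      using ne ideals by (blast intro: csubspace_zero two_sided_ideal_csubspace)
  next
    fix x y assume "x \<in> \<Union>\<C>" "y \<in> \<Union>\<C>"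
    then obtain I J where IJ: "I \<in> \<C>" "x \<in> I" "J \<in> \<C>" "y \<in> J"
      by blast
    then have "I \<subseteq> J \<or> J \<subseteq> I"
      using chain by (auto simp: subset_chain_def)
    then show "x + y \<in> \<Union>\<C>"
      using IJ ideals csubspace_add two_sided_ideal_csubspace by (metis UnionI subsetD)
  next
    fix c x assume "x \<in> \<Union>\<C>"
    then show "c *\<^sub>C x \<in> \<Union>\<C>"
      using ideals by (blast intro: csubspace_scale two_sided_ideal_csubspace)
  qed
qed (use ideals in \<open>blast dest: two_sided_idealD\<close>)+

lemma ideal_product_subset_iff:
  assumes "csubspace P"
  shows "ideal_product I J \<subseteq> P \<longleftrightarrow> (\<forall>x\<in>I. \<forall>y\<in>J. x * y \<in> P)"
  unfolding ideal_product_def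
  using complex_vector.span_minimal[OF _ assms] complex_vector.span_superset
  by (smt (verit) mem_Collect_eq subset_iff)

section \<open>Semiprime ideals as intersections of prime ideals\<close>

definition semiprime_ideal :: "'a::cstar_algebra set \<Rightarrow> bool" where
  "semiprime_ideal I \<longleftrightarrow> two_sided_ideal I \<and>
     (\<forall>J. two_sided_ideal J \<longrightarrow> (\<forall>x\<in>J. \<forall>y\<in>J. x * y \<in> I) \<longrightarrow> J \<subseteq> I)"

lemma prime_ideal_imp_semiprime: "prime_ideal P \<Longrightarrow> semiprime_ideal P"
  unfolding prime_ideal_def semiprime_ideal_def
  by (metis ideal_product_subset_iff two_sided_ideal_csubspace)

text \<open>
  Without a unit, \<open>x\<close> need not belong to the span of \<open>A x A\<close>, so the test ideals are annihilators
  modulo \<open>I\<close> instead of the ideal generated by \<open>x\<close>. They are two-sided and show first that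
  \<open>x A \<subseteq> I\<close>, and then that \<open>x \<in> I\<close>.
\<close>

lemma semiprime_ideal_elementwise:
  assumes I: "semiprime_ideal I" and x: "\<And>b. x * b * x \<in> I"
  shows "x \<in> I"
proof -
  have I': "two_sided_ideal I"
    and square: "\<And>J y. two_sided_ideal J \<Longrightarrow> (\<And>x y. x \<in> J \<Longrightarrow> y \<in> J \<Longrightarrow> x * y \<in> I) \<Longrightarrow> y \<in> J \<Longrightarrow> y \<in> I"
    using I unfolding semiprime_ideal_def by blast+
  note ideal = two_sided_idealD[OF I']
  note sub = csubspace_zero[OF ideal(1)] csubspace_add[OF ideal(1)] csubspace_scale[OF ideal(1)]
  define R where "R = {y. \<forall>b. y * b \<in> I}"
  define M where "M = {y. \<forall>b. x * b * y \<in> I}"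
  define N where "N = {y. \<forall>z\<in>M. y * z \<in> I}"
  have R: "two_sided_ideal R" unfolding R_def
    by (rule two_sided_idealI, rule csubspaceI)
      (auto simp: distrib_right mult_scaleC_left mult.assoc sub intro: ideal)
  have M: "two_sided_ideal M" unfolding M_def
  proof (rule two_sided_idealI, rule csubspaceI; clarsimp simp: distrib_left mult_scaleC_right sub)
    fix a y b assume *: "\<forall>b. x * b * y \<in> I"
    show "x * b * (a * y) \<in> I"
      using *[rule_format, of "b * a"] by (simp add: mult.assoc)
    show "x * b * (y * a) \<in> I"
      using ideal(3)[OF *[rule_format, of b], of a] by (simp add: mult.assoc)
  qed
  have N: "two_sided_ideal N" unfolding N_def
    by (rule two_sided_idealI, rule csubspaceI)
      (auto simp: distrib_right mult_scaleC_left mult.assoc sub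
        intro: ideal two_sided_ideal_mult_left[OF M])
  have "x \<in> M"
    using x by (simp add: M_def)
  have "x * b \<in> I" for b
  proof (rule square[of "M \<inter> N"])
    show "two_sided_ideal (M \<inter> N)"
      using two_sided_ideal_Inter[of "{M, N}"] M N by auto
    show "y * z \<in> I" if "y \<in> M \<inter> N" "z \<in> M \<inter> N" for y z
      using that by (auto simp: N_def)
    show "x * b \<in> M \<inter> N"
      using \<open>x \<in> M\<close> two_sided_ideal_mult_right[OF M] by (auto simp: N_def M_def)
  qed
  then have "x \<in> R"
    by (simp add: R_def)
  moreover have "y * z \<in> I" if "y \<in> R" for y z
    using that by (simp add: R_def)
  ultimately show ?thesis
    using square[OF R] by blast
qed

text \<open>
  The usual construction of a prime ideal avoiding \<open>x\<close>: the sequence \<open>s\<close> below starts at \<open>x\<close>,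
  avoids \<open>I\<close>, and each term factors through the previous one on both sides. So an ideal
  containing some \<open>s m\<close> contains all later terms; two ideals that both meet the sequence therefore
  share a term, and the next term lies in their product. This makes an ideal that is maximal among
  those avoiding \<open>s\<close> prime.
\<close>

lemma semiprime_closure_subset_semiprime:
  assumes I: "semiprime_ideal I"
  shows "semiprime_closure I \<subseteq> I"
proof
  fix x assume x: "x \<in> semiprime_closure I"
  show "x \<in> I"
  proof (rule ccontr)
    assume "x \<notin> I"
    have "\<exists>s. s 0 = x \<and> (\<forall>n. s n \<notin> I \<and> (\<exists>b. s (Suc n) = s n * b * s n))"
    proof -
      have "\<exists>s. \<forall>n. (s n \<notin> I \<and> (n = 0 \<longrightarrow> s n = x)) \<and> (\<exists>b. s (Suc n) = s n * b * s n)"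
      proof (rule dependent_nat_choice)
        show "\<exists>y. y \<notin> I \<and> ((0::nat) = 0 \<longrightarrow> y = x)"
          using \<open>x \<notin> I\<close> by blast
        show "\<exists>z. (z \<notin> I \<and> (Suc n = 0 \<longrightarrow> z = x)) \<and> (\<exists>b. z = y * b * y)"
          if "y \<notin> I \<and> (n = 0 \<longrightarrow> y = x)" for y n
          using that semiprime_ideal_elementwise[OF I, of y] by auto
      qed
      then show ?thesis by metis
    qed
    then obtain s where s0: "s 0 = x" and sI: "\<And>n. s n \<notin> I"
      and s_Suc: "\<And>n. \<exists>b. s (Suc n) = s n * b * s n"
      by blast
    define \<A> where "\<A> = {J. two_sided_ideal J \<and> I \<subseteq> J \<and> (\<forall>n. s n \<notin> J)}"
    have "\<exists>P\<in>\<A>. \<forall>J\<in>\<A>. P \<subseteq> J \<longrightarrow> J = P"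
    proof (rule subset_Zorn_nonempty)
      show "\<A> \<noteq> {}"
        using I sI by (auto simp: \<A>_def semiprime_ideal_def)
    next
      fix \<C> assume \<C>: "\<C> \<noteq> {}" "subset.chain \<A> \<C>"
      then have "\<C> \<subseteq> \<A>"
        by (simp add: subset_chain_def)
      moreover from this have "two_sided_ideal (\<Union>\<C>)"
        using \<C> by (intro two_sided_ideal_Union_chain) (auto simp: \<A>_def)
      ultimately show "\<Union>\<C> \<in> \<A>"
        using \<C>(1) unfolding \<A>_def by blast
    qed
    then obtain P where "P \<in> \<A>" and max: "\<And>J. J \<in> \<A> \<Longrightarrow> P \<subseteq> J \<Longrightarrow> J = P"
      by metis
    then have P: "two_sided_ideal P" "I \<subseteq> P" "\<And>n. s n \<notin> P"
      by (simp_all add: \<A>_def)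
    note subP = csubspace_zero[OF two_sided_ideal_csubspace[OF P(1)]]
      csubspace_add[OF two_sided_ideal_csubspace[OF P(1)]]
    have meets: "\<exists>m. \<forall>n\<ge>m. \<exists>p\<in>P. \<exists>j\<in>J. s n = p + j"
      if J: "two_sided_ideal J" "\<not> J \<subseteq> P" for J
    proof -
      define S where "S = {p + j | p j. p \<in> P \<and> j \<in> J}"
      have S: "two_sided_ideal S"
        unfolding S_def by (rule two_sided_ideal_sum[OF P(1) J(1)])
      have "0 \<in> J"
        by (rule csubspace_zero[OF two_sided_ideal_csubspace[OF J(1)]])
      then have "p \<in> S" if "p \<in> P" for p
        unfolding S_def using that by (intro CollectI exI[of _ p] exI[of _ 0]) simp
      then have "P \<subseteq> S" by blast
      have "j \<in> S" if "j \<in> J" for j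
        unfolding S_def using that subP(1) by (intro CollectI exI[of _ 0] exI[of _ j]) simp
      then have "S \<noteq> P"
        using J(2) by blast
      then have "S \<notin> \<A>"
        using max \<open>P \<subseteq> S\<close> by metis
      moreover have "I \<subseteq> S"
        using P(2) \<open>P \<subseteq> S\<close> by (rule subset_trans)
      ultimately obtain m where m: "s m \<in> S"
        using S by (auto simp: \<A>_def)
      have "s n \<in> S" if "n \<ge> m" for n
        using that
      proof (induction rule: dec_induct)
        case (step n)
        obtain b where "s (Suc n) = s n * b * s n"
          using s_Suc by blast
        then show ?case
          using two_sided_ideal_mult_left[OF S step.IH, of "s n * b"] by simp
      qed (rule m)
      then show ?thesis
        unfolding S_def by blast
    qed
    have "prime_ideal P"
      unfolding prime_ideal_def
    proof (intro conjI allI impI)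
      show "P \<noteq> UNIV" using P(3) by blast
    next
      fix J K assume J: "two_sided_ideal J" and K: "two_sided_ideal K"
        and JK: "ideal_product J K \<subseteq> P"
      show "J \<subseteq> P \<or> K \<subseteq> P"
      proof (rule ccontr)
        assume "\<not> (J \<subseteq> P \<or> K \<subseteq> P)"
        then obtain m m' where "\<forall>n\<ge>m. \<exists>p\<in>P. \<exists>j\<in>J. s n = p + j"
          "\<forall>n\<ge>m'. \<exists>p\<in>P. \<exists>k\<in>K. s n = p + k"
          using meets J K by meson
        then obtain p j q k where pj: "p \<in> P" "j \<in> J" "s (max m m') = p + j"
          and qk: "q \<in> P" "k \<in> K" "s (max m m') = q + k"
          by (meson max.cobounded1 max.cobounded2)
        obtain b where "s (Suc (max m m')) = s (max m m') * b * s (max m m')"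
          using s_Suc by blast
        also have "\<dots> = (p + j) * b * (q + k)"
          using pj(3) qk(3) by metis
        also have "\<dots> = p * (b * (q + k)) + (j * b) * q + j * (b * k)"
          by (simp add: algebra_simps)
        also have "\<dots> \<in> P"
        proof -
          have "j * (b * k) \<in> P"
            using JK pj(2) two_sided_ideal_mult_left[OF K qk(2)]
            by (simp add: ideal_product_subset_iff[OF two_sided_ideal_csubspace[OF P(1)]])
          then show ?thesis
            using two_sided_idealD(2,3)[OF P(1)] pj(1) qk(1) by (intro subP(2)) blast+
        qed
        finally show False
          using P(3) by blast
      qed
    qed (rule P(1))
    then have "x \<in> P"
      using x P(2) by (auto simp: semiprime_closure_def)
    then show False
      using P(3)[of 0] s0 by simp
  qed
qed

lemma semiprime_closure_superset: "I \<subseteq> semiprime_closure I"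
  by (auto simp: semiprime_closure_def)

lemma semiprime_closure_mono: "I \<subseteq> J \<Longrightarrow> semiprime_closure I \<subseteq> semiprime_closure J"
  by (auto simp: semiprime_closure_def)

section \<open>Commutators and Lie ideals\<close>

lemma commutator_span_subset_iff:
  assumes "csubspace S"
  shows "commutator_span E F \<subseteq> S \<longleftrightarrow> (\<forall>a\<in>E. \<forall>b\<in>F. commutator a b \<in> S)"
  unfolding commutator_span_def
  using complex_vector.span_minimal[OF _ assms] complex_vector.span_superset
  by (smt (verit) mem_Collect_eq subset_iff)

lemma commutator_in_span: "a \<in> E \<Longrightarrow> b \<in> F \<Longrightarrow> commutator a b \<in> commutator_span E F"
  unfolding commutator_span_def by (rule complex_vector.span_base) blast

lemma full_normalizer_iff:
  "csubspace L \<Longrightarrow> a \<in> full_normalizer L \<longleftrightarrow> (\<forall>b. commutator b a \<in> L)"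
  by (simp add: full_normalizer_def commutator_span_subset_iff)

lemma lie_ideal_iff:
  "lie_ideal L \<longleftrightarrow> csubspace L \<and> (\<forall>a. \<forall>x\<in>L. commutator a x \<in> L)"
  unfolding lie_ideal_def using commutator_span_subset_iff by blast

lemma commutator_flip_in:
  assumes "csubspace S" "commutator a b \<in> S"
  shows "commutator b a \<in> S"
  using complex_vector.subspace_neg[OF assms] by (simp add: commutator_def)

lemma two_sided_ideal_imp_lie_ideal: "two_sided_ideal I \<Longrightarrow> lie_ideal I"
  by (auto simp: lie_ideal_iff commutator_def intro: csubspace_diff dest: two_sided_idealD)

lemma lie_ideal_full_normalizer:
  assumes L: "lie_ideal L"
  shows "lie_ideal (full_normalizer L)"
proof -
  have sub: "csubspace L" and comm: "\<And>a x. x \<in> L \<Longrightarrow> commutator a x \<in> L"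
    using L by (auto simp: lie_ideal_iff)
  have "commutator b (x + y) = commutator b x + commutator b y"
    "commutator b (c *\<^sub>C x) = c *\<^sub>C commutator b x" "commutator b 0 = 0" for b x y :: 'a and c
    by (simp_all add: commutator_def algebra_simps mult_scaleC_left mult_scaleC_right
        complex_vector.scale_right_diff_distrib)
  then have "csubspace (full_normalizer L)"
    by (intro csubspaceI)
      (simp_all add: full_normalizer_iff[OF sub] csubspace_zero[OF sub] csubspace_add[OF sub]
        csubspace_scale[OF sub])
  then show ?thesis
    using comm by (simp add: lie_ideal_iff full_normalizer_iff[OF sub])
qed

text \<open>
  This is the identity \<open>[b, x y] = [b x, y] + [y b, x]\<close>, whose outer entries are again commutators
  with the given elements.
\<close>

lemma full_normalizer_mult:
  assumes L: "csubspace L" and x: "x \<in> full_normalizer L" and y: "y \<in> full_normalizer L"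
  shows "x * y \<in> full_normalizer L"
proof -
  have "commutator b (x * y) = commutator (b * x) y + commutator (y * b) x" for b
    by (simp add: commutator_def algebra_simps)
  then show ?thesis
    using x y by (simp add: full_normalizer_iff[OF L] csubspace_add[OF L])
qed

text \<open>
  For \<open>u, v \<in> U\<close> the Leibniz rule \<open>[u, v a] = [u,v] a + v [u,a]\<close> isolates \<open>[u,v] a\<close> inside \<open>U\<close>.
  Left factors are then moved to the right by commutators, which cost only elements of \<open>U\<close>. The
  generated ideal is reached as the ideal of those \<open>w \<in> U\<close> all of whose multiples stay in \<open>U\<close>.
\<close>

lemma ideal_generated_commutators_subset:
  assumes U: "lie_ideal U" and mult: "\<And>x y. x \<in> U \<Longrightarrow> y \<in> U \<Longrightarrow> x * y \<in> U"
  shows "ideal_generated (commutator_span U U) \<subseteq> U"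
proof -
  have sub: "csubspace U" and comm: "\<And>a x. x \<in> U \<Longrightarrow> commutator a x \<in> U"
    using U by (auto simp: lie_ideal_iff)
  note closed = csubspace_zero[OF sub] csubspace_add[OF sub] csubspace_scale[OF sub]
  define W where "W = {w \<in> U. (\<forall>a. w * a \<in> U) \<and> (\<forall>b. b * w \<in> U) \<and> (\<forall>a b. b * w * a \<in> U)}"
  have W: "two_sided_ideal W"
  proof (rule two_sided_idealI)
    show "csubspace W" unfolding W_def
      by (rule csubspaceI)
        (simp_all add: distrib_left distrib_right mult_scaleC_left mult_scaleC_right closed)
    show "a * w \<in> W" "w * a \<in> W" if "w \<in> W" for a w
      using that unfolding W_def by (simp_all flip: mult.assoc) (simp_all add: mult.assoc)
  qed
  have "commutator u v \<in> W" if u: "u \<in> U" and v: "v \<in> U" for u v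
  proof -
    have uv: "commutator u v \<in> U"
      by (rule comm[OF v])
    have right: "commutator u v * a \<in> U" for a
    proof -
      have "commutator u v * a = commutator u (v * a) - v * commutator u a"
        by (simp add: commutator_def algebra_simps)
      then show ?thesis
        using comm[OF u] commutator_flip_in[OF sub] mult[OF v] csubspace_diff[OF sub] by metis
    qed
    have left: "b * w \<in> U" if "w \<in> U" "w * b \<in> U" for b w
    proof -
      have "b * w = commutator b w + w * b"
        by (simp add: commutator_def)
      then show ?thesis
        using comm[OF that(1)] that(2) csubspace_add[OF sub] by metis
    qed
    show ?thesis
      unfolding W_def using uv right left[OF uv right] left[OF right]
      by (auto simp: mult.assoc)
  qed
  then have "commutator_span U U \<subseteq> W"
    by (simp add: commutator_span_subset_iff two_sided_ideal_csubspace[OF W])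
  then have "ideal_generated (commutator_span U U) \<subseteq> W"
    by (rule ideal_generated_minimal[OF _ W])
  then show ?thesis
    by (auto simp: W_def)
qed

text \<open>
  The derivation \<open>d = [a, \<cdot>]\<close> satisfies \<open>d\<^sup>2 = 0\<close> modulo \<open>Q\<close>. Expanding \<open>d\<^sup>2(x y)\<close> leaves
  \<open>2 d(x) d(y) = 0\<close>, and inserting \<open>y = z x\<close> gives \<open>d(x) z d(x) = 0\<close> for all \<open>z\<close>.
\<close>

lemma commutator_in_semiprime:
  assumes Q: "semiprime_ideal Q" and aa: "\<And>x. commutator a (commutator a x) \<in> Q"
  shows "commutator a x \<in> Q"
proof -
  have Q': "two_sided_ideal Q"
    using Q by (simp add: semiprime_ideal_def)
  note ideal = two_sided_idealD[OF Q']
  define d where "d = commutator a"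
  have dd: "d (d x) \<in> Q" for x
    using aa by (simp add: d_def)
  have leibniz: "d (x * y) = d x * y + x * d y" for x y
    by (simp add: d_def commutator_def algebra_simps)
  have prod: "d x * d y \<in> Q" for x y
  proof (rule csubspace_double[OF ideal(1)])
    have "d x * d y + d x * d y = d (d (x * y)) - d (d x) * y - x * d (d y)"
      by (simp add: d_def commutator_def algebra_simps)
    also have "\<dots> \<in> Q"
      by (intro csubspace_diff[OF ideal(1)] dd ideal(2,3)[OF dd])
    finally show "d x * d y + d x * d y \<in> Q" .
  qed
  have "d x * z * d x \<in> Q" for z
  proof -
    have "d x * z * d x = d x * d (z * x) - d x * d z * x"
      by (simp add: leibniz algebra_simps)
    also have "\<dots> \<in> Q"
      by (intro csubspace_diff[OF ideal(1)] prod ideal(3)[OF prod])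
    finally show ?thesis .
  qed
  then have "d x \<in> Q"
    by (rule semiprime_ideal_elementwise[OF Q])
  then show ?thesis
    by (simp add: d_def)
qed

section \<open>Semiprime Lie ideals\<close>

lemma semiprime_lie_ideal_full_normalizer:
  assumes L: "semiprime_lie_ideal L"
  shows "full_normalizer L = L"
proof
  have lie: "lie_ideal L" and sub: "csubspace L"
    using L by (auto simp: semiprime_lie_ideal_def lie_ideal_iff)
  show "L \<subseteq> full_normalizer L"
    using lie by (auto simp: full_normalizer_iff[OF sub] lie_ideal_iff)
  have "commutator_span (full_normalizer L) (full_normalizer L) \<subseteq> L"
    by (simp add: commutator_span_subset_iff[OF sub] full_normalizer_iff[OF sub])
  then show "full_normalizer L \<subseteq> L"
    using L lie_ideal_full_normalizer[OF lie] by (simp add: semiprime_lie_ideal_def)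
qed

text \<open>
  The largest ideal inside \<open>L\<close> is written as the set of elements whose generated ideal stays in
  \<open>L\<close>; a sum of two such ideals is again inside \<open>L\<close>.
\<close>

definition largest_ideal_within :: "'a::cstar_algebra set \<Rightarrow> 'a set" where
  "largest_ideal_within L = {x. ideal_generated {x} \<subseteq> L}"

lemma largest_ideal_within_subset: "largest_ideal_within L \<subseteq> L"
  using ideal_generated_superset by (fastforce simp: largest_ideal_within_def)

lemma largest_ideal_within_maximal:
  assumes "two_sided_ideal J" "J \<subseteq> L"
  shows "J \<subseteq> largest_ideal_within L"
proof
  fix x assume "x \<in> J"
  then have "ideal_generated {x} \<subseteq> J"
    by (intro ideal_generated_minimal assms(1)) simp
  then show "x \<in> largest_ideal_within L"
    using assms(2) by (auto simp: largest_ideal_within_def)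
qed

lemma two_sided_ideal_largest_ideal_within:
  assumes sub: "csubspace L"
  shows "two_sided_ideal (largest_ideal_within L)"
proof -
  let ?M = "largest_ideal_within L"
  have into: "ideal_generated {x} \<subseteq> ?M" if "x \<in> ?M" for x
    using that by (intro largest_ideal_within_maximal two_sided_ideal_generated)
      (simp add: largest_ideal_within_def)
  have gen: "x \<in> ideal_generated {x}" for x :: 'a
    using ideal_generated_superset by blast
  note ideal = two_sided_idealD[OF two_sided_ideal_generated]
  show ?thesis
  proof (rule two_sided_idealI, rule csubspaceI)
    have "{0} \<subseteq> ?M"
      by (rule largest_ideal_within_maximal)
        (auto intro!: two_sided_idealI complex_vector.subspace_single_0 csubspace_zero[OF sub])
    then show "0 \<in> ?M" by simp
  next
    fix x y assume xy: "x \<in> ?M" "y \<in> ?M"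
    let ?S = "{u + v | u v. u \<in> ideal_generated {x} \<and> v \<in> ideal_generated {y}}"
    have "?S \<subseteq> ?M"
    proof (rule largest_ideal_within_maximal)
      show "?S \<subseteq> L"
        using xy csubspace_add[OF sub] by (auto simp: largest_ideal_within_def)
    qed (intro two_sided_ideal_sum two_sided_ideal_generated)
    then show "x + y \<in> ?M"
      using gen by blast
  next
    fix c x assume "x \<in> ?M"
    then show "c *\<^sub>C x \<in> ?M"
      using into csubspace_scale[OF ideal(1) gen] by blast
  next
    fix a x assume "x \<in> ?M"
    then show "a * x \<in> ?M" "x * a \<in> ?M"
      using into ideal(2,3)[OF gen] by blast+
  qed
qed

lemma semiprime_largest_ideal_within:
  assumes L: "semiprime_lie_ideal L"
  shows "semiprime_ideal (largest_ideal_within L)"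
  unfolding semiprime_ideal_def
proof (intro conjI allI impI)
  have sub: "csubspace L"
    using L by (auto simp: semiprime_lie_ideal_def lie_ideal_iff)
  show "two_sided_ideal (largest_ideal_within L)"
    by (rule two_sided_ideal_largest_ideal_within[OF sub])
  fix J assume J: "two_sided_ideal J" and JJ: "\<forall>x\<in>J. \<forall>y\<in>J. x * y \<in> largest_ideal_within L"
  have "x * y \<in> L" if "x \<in> J" "y \<in> J" for x y
    using JJ that largest_ideal_within_subset by blast
  then have "commutator_span J J \<subseteq> L"
    by (simp add: commutator_span_subset_iff[OF sub] commutator_def csubspace_diff[OF sub])
  then have "J \<subseteq> L"
    using L two_sided_ideal_imp_lie_ideal[OF J] by (simp add: semiprime_lie_ideal_def)
  then show "J \<subseteq> largest_ideal_within L"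
    by (rule largest_ideal_within_maximal[OF J])
qed

theorem lemma2p6:
  fixes L I\<^sub>0 I\<^sub>m\<^sub>i\<^sub>n :: "'a::cstar_algebra set"
  assumes "semiprime_lie_ideal L"
    and "I\<^sub>0 = ideal_generated (commutator_span L L)"
    and "I\<^sub>m\<^sub>i\<^sub>n = ideal_generated (commutator_span UNIV L)"
  shows "I\<^sub>0 \<subseteq> I\<^sub>m\<^sub>i\<^sub>n \<and> I\<^sub>m\<^sub>i\<^sub>n \<subseteq> semiprime_closure I\<^sub>m\<^sub>i\<^sub>n \<and>
      semiprime_closure I\<^sub>m\<^sub>i\<^sub>n = semiprime_closure I\<^sub>0 \<and>
      L = full_normalizer (semiprime_closure I\<^sub>m\<^sub>i\<^sub>n)"
proof -
  have lie: "lie_ideal L" and sub: "csubspace L"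
    using assms(1) by (auto simp: semiprime_lie_ideal_def lie_ideal_iff)
  have normalizer: "full_normalizer L = L"
    by (rule semiprime_lie_ideal_full_normalizer[OF assms(1)])

  have "commutator_span L L \<subseteq> commutator_span UNIV L"
    unfolding commutator_span_def by (rule complex_vector.span_mono) blast
  then have I0_min: "I\<^sub>0 \<subseteq> I\<^sub>m\<^sub>i\<^sub>n"
    unfolding assms(2,3)
    by (intro ideal_generated_minimal two_sided_ideal_generated)
      (use ideal_generated_superset in blast)

  have prime: "I\<^sub>m\<^sub>i\<^sub>n \<subseteq> P" if P: "prime_ideal P" and I0P: "I\<^sub>0 \<subseteq> P" for P
  proof -
    have ideal: "two_sided_ideal P"
      using P by (simp add: prime_ideal_def)
    note subP = two_sided_ideal_csubspace[OF ideal]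
    have "commutator a b \<in> P" if "b \<in> L" for a b
    proof -
      have "commutator b (commutator b x) \<in> P" for x
      proof -
        have "commutator b x \<in> L"
          using lie that commutator_flip_in[OF sub] by (auto simp: lie_ideal_iff)
        then show ?thesis
          using that I0P ideal_generated_superset commutator_in_span
          unfolding assms(2) by blast
      qed
      then have "commutator b a \<in> P"
        by (rule commutator_in_semiprime[OF prime_ideal_imp_semiprime[OF P]])
      then show ?thesis
        by (rule commutator_flip_in[OF subP])
    qed
    then have "commutator_span UNIV L \<subseteq> P"
      by (simp add: commutator_span_subset_iff[OF subP])
    then show ?thesis
      unfolding assms(3) by (rule ideal_generated_minimal[OF _ ideal])
  qed
  have closures: "semiprime_closure I\<^sub>m\<^sub>i\<^sub>n = semiprime_closure I\<^sub>0"
    using I0_min prime unfolding semiprime_closure_def by blast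

  have "x * y \<in> L" if "x \<in> L" "y \<in> L" for x y
    using full_normalizer_mult[OF sub] that normalizer by blast
  then have "I\<^sub>0 \<subseteq> L"
    unfolding assms(2) by (rule ideal_generated_commutators_subset[OF lie])
  then have "I\<^sub>0 \<subseteq> largest_ideal_within L"
    unfolding assms(2) by (intro largest_ideal_within_maximal two_sided_ideal_generated)
  then have "semiprime_closure I\<^sub>0 \<subseteq> L"
    using semiprime_closure_mono
      semiprime_closure_subset_semiprime[OF semiprime_largest_ideal_within[OF assms(1)]]
      largest_ideal_within_subset by blast
  then have "full_normalizer (semiprime_closure I\<^sub>m\<^sub>i\<^sub>n) \<subseteq> full_normalizer L"
    unfolding closures by (auto simp: full_normalizer_def)
  moreover have "L \<subseteq> full_normalizer (semiprime_closure I\<^sub>m\<^sub>i\<^sub>n)"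
  proof
    fix x assume "x \<in> L"
    then have "commutator_span UNIV {x} \<subseteq> commutator_span UNIV L"
      unfolding commutator_span_def by (intro complex_vector.span_mono) blast
    also have "\<dots> \<subseteq> semiprime_closure I\<^sub>m\<^sub>i\<^sub>n"
      using ideal_generated_superset semiprime_closure_superset unfolding assms(3) by blast
    finally show "x \<in> full_normalizer (semiprime_closure I\<^sub>m\<^sub>i\<^sub>n)"
      by (simp add: full_normalizer_def)
  qed
  ultimately show ?thesis
    using I0_min closures semiprime_closure_superset normalizer by blast
qed

end
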